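(* Let $\mathcal{A}=A\oplus P$ be a diolic algebra over $\mathbb{K}$ and $k\geq 1$. (i) A graded differential operator of degree $0$ and order $\le k$ from $\mathcal{A}$ to $\mathcal{A}$ is a pair $\Box_0=(\Box_0^A,\Box_0^P)$ with $\Box_0^A\in\mathrm{Diff}_k(A,A)$ and $\Box_0^P\in\mathrm{Diff}_k(P,P)$ satisfying $\delta_a^k(\Box_0^A)=\delta_a^k(\Box_0^P)$ for all $a\in A$ (i.e. they have the same scalar-type symbol). (ii) The graded differential operators of degree $1$ and order $\le k$ are precisely the $P$-valued differential operators of order $\le k$ on $A$; that is, there is an isomorphism of $A$-modules $\mathrm{Diff}_k(\mathcal{A})_1\cong\mathrm{Diff}_k(A,P)$. (iii) When $P$ is a projective module of rank $1$, there exist diolic differential operators of degree $-1$, which are elements of $\mathrm{Diff}_k(P,A)$.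
   Context: $\mathbb{K}$ is a field of characteristic $0$. A diolic algebra is a $\mathbb{Z}$-graded commutative $\mathbb{K}$-algebra $\mathcal{A}=\mathcal{A}_0\oplus\mathcal{A}_1$ with $\mathcal{A}_0=A$ a commutative unital $\mathbb{K}$-algebra, $\mathcal{A}_1=P$ an $A$-module, $\mathcal{A}_i=0$ for $i\ne 0,1$; the products are the multiplication of $A$, the module action $A\cdot P\subseteq P$, and $P\cdot P=0$. For graded $\mathcal{A}$-modules $\mathcal{P},\mathcal{Q}$, a homogeneous $\mathbb{K}$-linear map $\varphi:\mathcal{P}\to\mathcal{Q}$ and homogeneous $a\in\mathcal{A}$ put $\delta_a\varphi:=a\circ\varphi-(-1)^{\deg a\,\deg\varphi}\varphi\circ a$, where $a$ also denotes multiplication by $a$, and $\delta_{a_0,\dots,a_k}:=\delta_{a_0}\circ\cdots\circ\delta_{a_k}$. A map $\varphi$ of degree $g$ is a graded differential operator of order $\leq k$ if $\delta_{a_0,\dots,a_k}(\varphi)=0$ for all homogeneous $a_0,\dots,a_k\in\mathcal{A}$; these form $\mathrm{Diff}_k(\mathcal{P},\mathcal{Q})_g$, and $\mathrm{Diff}_k(\mathcal{A})_g:=\mathrm{Diff}_k(\mathcal{A},\mathcal{A})_g$. $\mathrm{Diff}_k(Q,R)$ for $A$-modules $Q,R$ is the ordinary (ungraded) version over $A$. $\delta_a^k=\delta_a\circ\cdots\circ\delta_a$ ($k$ times). For $\Box_0^A,\Box_0^P$ of order $\leq k$, $\delta_a^k(\Box_0^A)$ is multiplication on $A$ by an element $f\in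 A$, and $\delta_a^k(\Box_0^A)=\delta_a^k(\Box_0^P)$ means that $\delta_a^k(\Box_0^P)$ is multiplication on $P$ by the same $f$. $\Box_0^A,\Box_0^P$ are the restrictions of $\Box_0$ to $A$ and $P$. *)

theory Defs
  imports Complex_Main "HOL-Library.Product_Plus" "HOL-Library.Function_Algebras"
    "HOL-Library.Poly_Mapping"
begin

section \<open>Diolic algebras\<close>

locale diolic_algebra =
  vector_space scA + P: module sm
  for scA :: "'k::field_char_0 \<Rightarrow> 'a::comm_ring_1 \<Rightarrow> 'a"
    and sm :: "'a \<Rightarrow> 'p::ab_group_add \<Rightarrow> 'p" +
  assumes scA_mult: "scA c (a * b) = scA c a * b"

text \<open>The total algebra is the direct sum, carried by the product type.\<close>

definition dmult :: "('a::comm_ring_1 \<Rightarrow> 'p::ab_group_add \<Rightarrow> 'p) \<Rightarrow> 'a \<times> 'p \<Rightarrow> 'a \<times> 'p \<Rightarrow> 'a \<times> 'p"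
  where "dmult sm x y = (fst x * fst y, sm (fst x) (snd y) + sm (fst y) (snd x))"

definition dgrade :: "int \<Rightarrow> ('a::comm_ring_1 \<times> 'p::ab_group_add) set"
  where "dgrade i = (if i = 0 then UNIV \<times> {0} else if i = 1 then {0} \<times> UNIV else {0})"

text \<open>An \<open>A\<close>-module is a vector space over the ground field through \<open>c \<mapsto> c \<cdot> 1\<close>.\<close>

definition base_scale ::
    "('k \<Rightarrow> 'a::comm_ring_1 \<Rightarrow> 'a) \<Rightarrow> ('a \<Rightarrow> 'm \<Rightarrow> 'm) \<Rightarrow> 'k \<Rightarrow> 'm \<Rightarrow> 'm"
  where "base_scale scA act c x = act (scA c 1) x"

definition dscale ::
    "('k \<Rightarrow> 'a::comm_ring_1 \<Rightarrow> 'a) \<Rightarrow> ('a \<Rightarrow> 'p::ab_group_add \<Rightarrow> 'p) \<Rightarrow> 'k \<Rightarrow> 'a \<times> 'p \<Rightarrow> 'a \<times> 'p"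
  where "dscale scA sm c x = (scA c (fst x), base_scale scA sm c (snd x))"

section \<open>Differential operators\<close>

definition delta ::
    "('a \<Rightarrow> 'q \<Rightarrow> 'q) \<Rightarrow> ('a \<Rightarrow> 'r \<Rightarrow> 'r) \<Rightarrow> 'a \<Rightarrow> ('q \<Rightarrow> 'r::ab_group_add) \<Rightarrow> 'q \<Rightarrow> 'r"
  where "delta actQ actR a D = (\<lambda>x. actR a (D x) - D (actQ a x))"

definition Diff ::
    "('k::field_char_0 \<Rightarrow> 'a::comm_ring_1 \<Rightarrow> 'a) \<Rightarrow> ('a \<Rightarrow> 'q::ab_group_add \<Rightarrow> 'q) \<Rightarrow>
      ('a \<Rightarrow> 'r::ab_group_add \<Rightarrow> 'r) \<Rightarrow> nat \<Rightarrow> ('q \<Rightarrow> 'r) set"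
  where "Diff scA actQ actR k =
    {D. Vector_Spaces.linear (base_scale scA actQ) (base_scale scA actR) D \<and>
        (\<forall>as. length as = Suc k \<longrightarrow> foldr (delta actQ actR) as D = (\<lambda>_. 0))}"

text \<open>
  In the graded case the sign needs the degrees, which are passed explicitly since they are not
  determined by the zero element or the zero map: \<open>i\<close> is the degree of \<open>a\<close>, \<open>g\<close> that of \<open>\<phi>\<close>.
  A list of factors carries the degree of each entry; \<open>\<delta>\<close> raises the degree of the map by \<open>i\<close>.
\<close>

definition gdelta ::
    "('b \<Rightarrow> 'q \<Rightarrow> 'q) \<Rightarrow> ('b \<Rightarrow> 'r \<Rightarrow> 'r) \<Rightarrow> int \<Rightarrow> int \<Rightarrow> 'b \<Rightarrow> ('q \<Rightarrow> 'r::ab_group_add) \<Rightarrow> 'q \<Rightarrow> 'r"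
  where "gdelta actQ actR i g a \<phi> =
    (\<lambda>x. actR a (\<phi> x) - (if even (i * g) then \<phi> (actQ a x) else - \<phi> (actQ a x)))"

fun gdeltas ::
    "('b \<Rightarrow> 'q \<Rightarrow> 'q) \<Rightarrow> ('b \<Rightarrow> 'r \<Rightarrow> 'r) \<Rightarrow> int \<Rightarrow> (int \<times> 'b) list \<Rightarrow> ('q \<Rightarrow> 'r::ab_group_add) \<Rightarrow> 'q \<Rightarrow> 'r"
  where
    "gdeltas actQ actR g [] \<phi> = \<phi>"
  | "gdeltas actQ actR g ((i, a) # xs) \<phi> =
       gdelta actQ actR i (g + sum_list (map fst xs)) a (gdeltas actQ actR g xs \<phi>)"

definition graded_Diff ::
    "(int \<Rightarrow> 'b set) \<Rightarrow>
      ('k::field_char_0 \<Rightarrow> 'q::ab_group_add \<Rightarrow> 'q) \<Rightarrow> ('b \<Rightarrow> 'q \<Rightarrow> 'q) \<Rightarrow> (int \<Rightarrow> 'q set) \<Rightarrow>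
      ('k \<Rightarrow> 'r::ab_group_add \<Rightarrow> 'r) \<Rightarrow> ('b \<Rightarrow> 'r \<Rightarrow> 'r) \<Rightarrow> (int \<Rightarrow> 'r set) \<Rightarrow>
      nat \<Rightarrow> int \<Rightarrow> ('q \<Rightarrow> 'r) set"
  where "graded_Diff gradeA scQ actQ gradeQ scR actR gradeR k g =
    {\<phi>. Vector_Spaces.linear scQ scR \<phi> \<and>
        (\<forall>i. \<phi> ` gradeQ i \<subseteq> gradeR (i + g)) \<and>
        (\<forall>xs. length xs = Suc k \<and> (\<forall>(i, a) \<in> set xs. a \<in> gradeA i) \<longrightarrow>
               gdeltas actQ actR g xs \<phi> = (\<lambda>_. 0))}"

definition diolic_Diff ::
    "('k::field_char_0 \<Rightarrow> 'a::comm_ring_1 \<Rightarrow> 'a) \<Rightarrow> ('a \<Rightarrow> 'p::ab_group_add \<Rightarrow> 'p) \<Rightarrow>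
      nat \<Rightarrow> int \<Rightarrow> ('a \<times> 'p \<Rightarrow> 'a \<times> 'p) set"
  where "diolic_Diff scA sm k g =
    graded_Diff dgrade (dscale scA sm) (dmult sm) dgrade (dscale scA sm) (dmult sm) dgrade k g"

definition same_symbol ::
    "('a::comm_ring_1 \<Rightarrow> 'p::ab_group_add \<Rightarrow> 'p) \<Rightarrow> nat \<Rightarrow> ('a \<Rightarrow> 'a) \<Rightarrow> ('p \<Rightarrow> 'p) \<Rightarrow> bool"
  where "same_symbol sm k D E \<longleftrightarrow>
    (\<forall>a. \<exists>f. (delta (*) (*) a ^^ k) D = (\<lambda>b. f * b) \<and> (delta sm sm a ^^ k) E = (\<lambda>p. sm f p))"

section \<open>Isomorphisms of submodules\<close>

text \<open>Modules of operators are submodules of a type of functions with pointwise operations.\<close>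

definition submodule_iso ::
    "('a::comm_ring_1 \<Rightarrow> 'm::ab_group_add \<Rightarrow> 'm) \<Rightarrow> 'm set \<Rightarrow>
      ('a \<Rightarrow> 'n::ab_group_add \<Rightarrow> 'n) \<Rightarrow> 'n set \<Rightarrow> ('m \<Rightarrow> 'n) \<Rightarrow> bool"
  where "submodule_iso s1 M s2 N f \<longleftrightarrow>
    module s1 \<and> module s2 \<and> module.subspace s1 M \<and> module.subspace s2 N \<and>
    bij_betw f M N \<and>
    (\<forall>x\<in>M. \<forall>y\<in>M. f (x + y) = f x + f y) \<and> (\<forall>a. \<forall>x\<in>M. f (s1 a x) = s2 a (f x))"

section \<open>Projective modules of rank one\<close>

definition free_scale :: "'a::comm_ring_1 \<Rightarrow> ('i \<Rightarrow>\<^sub>0 'a) \<Rightarrow> ('i \<Rightarrow>\<^sub>0 'a)"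
  where "free_scale a = Poly_Mapping.map ((*) a)"

lemma lookup_free_scale [simp]: "Poly_Mapping.lookup (free_scale a x) i = a * Poly_Mapping.lookup x i"
  by (cases "Poly_Mapping.lookup x i = 0") (simp_all add: free_scale_def Poly_Mapping.map.rep_eq when_def)

lemma module_free_scale: "module (free_scale :: 'a::comm_ring_1 \<Rightarrow> ('i \<Rightarrow>\<^sub>0 'a) \<Rightarrow> _)"
  by unfold_locales (auto intro!: poly_mapping_eqI simp: lookup_add algebra_simps)

text \<open>
  Direct summand of a free module. Indexing the free module by the elements of the module itself
  loses no generality: a projective module is a quotient of that free module, and the quotient
  map splits.
\<close>

definition projective_module :: "('a::comm_ring_1 \<Rightarrow> 'p::ab_group_add \<Rightarrow> 'p) \<Rightarrow> bool"
  where "projective_module sm \<longleftrightarrow>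
    (\<exists>(\<iota> :: 'p \<Rightarrow> ('p \<Rightarrow>\<^sub>0 'a)) \<pi>.
       module_hom sm free_scale \<iota> \<and> module_hom free_scale sm \<pi> \<and> (\<forall>p. \<pi> (\<iota> p) = p))"

definition prime_ideal :: "'a::comm_ring_1 set \<Rightarrow> bool"
  where "prime_ideal I \<longleftrightarrow>
    module.subspace (*) I \<and> 1 \<notin> I \<and> (\<forall>a b. a * b \<in> I \<longrightarrow> a \<in> I \<or> b \<in> I)"

text \<open>
  Localization of a module at a multiplicative set \<open>S\<close>: \<open>loc_frac act S p s\<close> is the fraction
  \<open>p / s\<close> as an equivalence class of pairs. The ring itself is the case \<open>act = (*)\<close>.
\<close>

definition loc_frac ::
    "('a::comm_ring_1 \<Rightarrow> 'm::ab_group_add \<Rightarrow> 'm) \<Rightarrow> 'a set \<Rightarrow> 'm \<Rightarrow> 'a \<Rightarrow> ('m \<times> 'a) set"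
  where "loc_frac act S p s = {(q, t). t \<in> S \<and> (\<exists>u\<in>S. act u (act t p - act s q) = 0)}"

definition loc_carrier ::
    "('a::comm_ring_1 \<Rightarrow> 'm::ab_group_add \<Rightarrow> 'm) \<Rightarrow> 'a set \<Rightarrow> ('m \<times> 'a) set set"
  where "loc_carrier act S = {loc_frac act S p s | p s. s \<in> S}"

definition loc_scale ::
    "('a::comm_ring_1 \<Rightarrow> 'm::ab_group_add \<Rightarrow> 'm) \<Rightarrow> 'a set \<Rightarrow> ('a \<times> 'a) set \<Rightarrow> ('m \<times> 'a) set \<Rightarrow> ('m \<times> 'a) set"
  where "loc_scale act S X Y = (\<Union>(a, s)\<in>X. \<Union>(p, t)\<in>Y. loc_frac act S (act a p) (s * t))"

text \<open>
  Rank one: at every prime the localization is free on one generator. Finite generation is not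
  imposed separately; it follows for projective modules of constant rank one.
\<close>

definition rank_one :: "('a::comm_ring_1 \<Rightarrow> 'p::ab_group_add \<Rightarrow> 'p) \<Rightarrow> bool"
  where "rank_one sm \<longleftrightarrow>
    (\<forall>I. prime_ideal I \<longrightarrow>
       (\<exists>e\<in>loc_carrier sm (- I). \<forall>x\<in>loc_carrier sm (- I).
          \<exists>!\<alpha>. \<alpha> \<in> loc_carrier (*) (- I) \<and> x = loc_scale sm (- I) \<alpha> e))"

end

theory Submission
  imports Defs
begin

text \<open>
  The grading forces an operator on \<open>A \<oplus> P\<close> of degree \<open>0\<close>, \<open>1\<close> or \<open>-1\<close> into a simple shape: \<open>D \<oplus> E\<close> in degree
  \<open>0\<close>, a map \<open>F : A \<rightarrow> P\<close> extended by zero on \<open>P\<close> in degree \<open>1\<close>, and a map \<open>X : P \<rightarrow> A\<close> extended by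
  zero on \<open>A\<close> in degree \<open>-1\<close>. What remains is to see which of these maps have graded order
  \<open>\<le> k\<close>. Commuting with \<open>a \<in> A\<close> acts on the components as the ordinary \<open>\<delta>\<^sub>a\<close>, so only the effect
  of \<open>\<delta>\<^sub>p\<close> with \<open>p \<in> P\<close> is new.

  In degree \<open>1\<close>, \<open>\<delta>\<^sub>p F\<close> has degree \<open>2\<close> and vanishes, so the graded and the ordinary order agree
  (\<open>graded_order_below_degree_one_map_iff\<close>) and extension by zero is the inverse isomorphism.

  In degree \<open>0\<close>, \<open>\<delta>\<^sub>p (D \<oplus> E)\<close> is the degree one operator \<open>b \<mapsto> D(b) p - E(b p)\<close>, called the action
  defect here. By the case of degree \<open>1\<close>, order \<open>\<le> k\<close> means order \<open>\<le> k\<close> for \<open>D\<close> and \<open>E\<close> and order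
  \<open>\<le> k - 1\<close> for all action defects (\<open>graded_order_below_map_prod_iff\<close>). The latter is a condition on
  \<open>\<delta>\<close> at \<open>k\<close> arbitrary elements of \<open>A\<close>, while equality of symbols is about the powers \<open>\<delta>\<^sub>a\<^sup>k\<close> only.
  Since \<open>\<delta>\<close> is additive in its index and the \<open>\<delta>\<^sub>a\<close> commute, polarization in characteristic zero
  makes the two equivalent (\<open>order_below_iff_delta_pow\<close>). Finally \<open>\<delta>\<^sub>a\<^sup>k\<close> of an action defect is the
  action defect of \<open>\<delta>\<^sub>a\<^sup>k D\<close> and \<open>\<delta>\<^sub>a\<^sup>k E\<close>; as \<open>\<delta>\<^sub>a\<^sup>k D\<close> is multiplication by some \<open>f\<close>, it vanishes for all
  \<open>p\<close> exactly when \<open>\<delta>\<^sub>a\<^sup>k E\<close> is multiplication by the same \<open>f\<close> (\<open>same_symbol_iff_order_below\<close>).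

  In degree \<open>-1\<close>, take an \<open>A\<close>-linear functional \<open>X\<close> on \<open>P\<close>. Then \<open>\<delta>\<^sub>a X = 0\<close>, and \<open>\<delta>\<^sub>p X\<close> is
  \<open>b \<mapsto> X(p) b\<close> on \<open>A\<close> and \<open>q \<mapsto> X(q) p\<close> on \<open>P\<close>. If \<open>X(q) p = X(p) q\<close>, this is multiplication by \<open>X(p)\<close>,
  of order zero, so \<open>X\<close> has order \<open>\<le> 1 \<le> k\<close>. In rank one the identity holds because it may be
  checked at every prime, where \<open>p\<close> and \<open>q\<close> are multiples of one generator. A module of rank one
  is not zero, and a nonzero projective module has a nonzero functional, namely a coordinate in an
  ambient free module.
\<close>

section \<open>The order of a differential operator\<close>

text \<open>
  Counting the number of commutators, instead of the order, makes the vanishing of the operator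
  itself the base case \<open>n = 0\<close>; order \<open>\<le> k\<close> is \<open>order_below (Suc k)\<close>.
\<close>

definition order_below ::
    "('a \<Rightarrow> 'q \<Rightarrow> 'q) \<Rightarrow> ('a \<Rightarrow> 'r \<Rightarrow> 'r) \<Rightarrow> nat \<Rightarrow> ('q \<Rightarrow> 'r::ab_group_add) \<Rightarrow> bool"
  where "order_below s t n D \<longleftrightarrow>
    (\<forall>as. length as = n \<longrightarrow> foldr (delta s t) as D = (\<lambda>_. 0))"

lemma order_below_0 [simp]: "order_below s t 0 D \<longleftrightarrow> D = (\<lambda>_. 0)"
  by (simp add: order_below_def)

lemma order_below_Suc:
  "order_below s t (Suc n) D \<longleftrightarrow> (\<forall>a. order_below s t n (delta s t a D))"
proof
  assume D: "order_below s t (Suc n) D"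
  show "\<forall>a. order_below s t n (delta s t a D)"
    unfolding order_below_def
  proof (intro allI impI)
    fix a as assume "length (as :: 'a list) = n"
    then have "foldr (delta s t) (as @ [a]) D = (\<lambda>_. 0)"
      using D unfolding order_below_def by (metis length_append_singleton)
    then show "foldr (delta s t) as (delta s t a D) = (\<lambda>_. 0)"
      by simp
  qed
next
  assume D: "\<forall>a. order_below s t n (delta s t a D)"
  show "order_below s t (Suc n) D"
    unfolding order_below_def
  proof (intro allI impI)
    fix as assume "length (as :: 'a list) = Suc n"
    then obtain bs a where "as = bs @ [a]" "length bs = n"
      by (auto simp: length_Suc_conv_rev)
    then show "foldr (delta s t) as D = (\<lambda>_. 0)"
      using D by (simp add: order_below_def)
  qed
qed

lemma in_Diff_iff:
  "D \<in> Diff scA s t k \<longleftrightarrow>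
    Vector_Spaces.linear (base_scale scA s) (base_scale scA t) D \<and> order_below s t (Suc k) D"
  by (simp add: Diff_def order_below_def)

lemma delta_add_operator:
  assumes "module t"
  shows "delta s t a (\<lambda>x. D x + E x) = (\<lambda>x. delta s t a D x + delta s t a E x)"
proof -
  interpret module t by fact
  show ?thesis by (simp add: delta_def algebra_simps)
qed

lemma delta_scale_operator:
  assumes "module t"
  shows "delta s t a (\<lambda>x. t c (D x)) = (\<lambda>x. t c (delta s t a D x))"
proof -
  interpret module t by fact
  show ?thesis by (simp add: delta_def algebra_simps)
qed

lemma delta_sum_operator:
  assumes "module t"
  shows "delta s t a (\<lambda>x. \<Sum>i\<in>I. D i x) = (\<lambda>x. \<Sum>i\<in>I. delta s t a (D i) x)"
proof -
  interpret module t by fact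
  show ?thesis by (simp add: delta_def scale_sum_right sum_subtractf)
qed

lemma delta_zero_operator [simp]:
  assumes "module t"
  shows "delta s t a (\<lambda>_. 0) = (\<lambda>_. 0)"
proof -
  interpret module t by fact
  show ?thesis by (simp add: delta_def)
qed

lemma delta_commute:
  assumes "module s" "module t"
  shows "delta s t a (delta s t b D) = delta s t b (delta s t a D)"
proof -
  interpret s: module s by fact
  interpret t: module t by fact
  show ?thesis by (simp add: delta_def t.scale_right_diff_distrib mult.commute algebra_simps)
qed

lemma delta_pow_commute:
  assumes "module s" "module t"
  shows "delta s t b ((delta s t a ^^ j) D) = (delta s t a ^^ j) (delta s t b D)"
  by (induction j) (simp_all add: delta_commute[OF assms, of b a])

lemma additive_delta:
  assumes "module s" "module t" "additive D"
  shows "additive (delta s t a D)"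
proof -
  interpret s: module s by fact
  interpret t: module t by fact
  interpret additive D by fact
  show ?thesis by unfold_locales (simp add: delta_def s.scale_right_distrib t.scale_right_distrib add)
qed

lemma additive_delta_pow:
  assumes "module s" "module t" "additive D"
  shows "additive ((delta s t a ^^ j) D)"
  by (induction j) (simp_all add: assms additive_delta)

lemma order_below_zero_operator [simp]: "module t \<Longrightarrow> order_below s t n (\<lambda>_. 0)"
  by (induction n) (simp_all add: order_below_Suc)

lemma order_below_add:
  assumes "module t"
  shows "order_below s t n D \<Longrightarrow> order_below s t n E \<Longrightarrow> order_below s t n (\<lambda>x. D x + E x)"
proof (induction n arbitrary: D E)
  case 0
  then show ?case by simp
next
  case (Suc n)
  then show ?case by (simp add: order_below_Suc delta_add_operator[OF assms])
qed

lemma order_below_scale: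
  assumes "module t"
  shows "order_below s t n D \<Longrightarrow> order_below s t n (\<lambda>x. t c (D x))"
proof (induction n arbitrary: D)
  case 0
  interpret module t by fact
  from 0 show ?case by simp
next
  case (Suc n)
  then show ?case by (simp add: order_below_Suc delta_scale_operator[OF assms])
qed

lemma order_below_multiplication:
  assumes "module t"
  shows "order_below t t (Suc 0) (t c)"
proof -
  interpret module t by fact
  show ?thesis by (simp add: order_below_Suc delta_def mult.commute)
qed

section \<open>Polarization of the symbol\<close>

text \<open>Comparing \<open>f (2 n)\<close> with \<open>2 ^ j * f n\<close> removes the top coefficient and multiplies the other
  ones by nonzero integers, which gives an induction on the degree.\<close>

lemma polynomial_identity_coeffs:
  assumes "module t"
    and torsion_free: "\<And>n x. n \<noteq> 0 \<Longrightarrow> t (of_nat n) x = 0 \<Longrightarrow> x = 0"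
    and "\<And>n::nat. (\<Sum>i\<le>j. t (of_nat (n ^ i)) (c i)) = 0" and "i \<le> j"
  shows "c i = 0"
  using assms(3,4)
proof (induction j arbitrary: c i)
  case 0
  interpret module t by fact
  show ?case using 0(1)[of 1] 0(2) by simp
next
  case (Suc j)
  interpret module t by fact
  have zero_below: "c i = 0" if "i \<le> j" for i
  proof -
    define d where "d = (\<lambda>i. t (of_nat (2 ^ Suc j - 2 ^ i)) (c i))"
    have d_eq: "t (of_nat (n ^ i)) (d i)
        = t (2 ^ Suc j) (t (of_nat (n ^ i)) (c i)) - t (of_nat ((2 * n) ^ i)) (c i)"
      if "i \<le> Suc j" for i n
    proof -
      have "(2::nat) ^ i \<le> 2 ^ Suc j"
        using that by (intro power_increasing) auto
      then have "of_nat (2 ^ Suc j - 2 ^ i) = (2 ^ Suc j - 2 ^ i :: 'a)"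
        by (simp add: of_nat_diff)
      then show ?thesis
        unfolding d_def
        by (simp add: power_mult_distrib scale_left_diff_distrib scale_right_diff_distrib
            mult.commute
            del: power_Suc)
    qed
    have "(\<Sum>i\<le>j. t (of_nat (n ^ i)) (d i)) = 0" for n
    proof -
      have "(\<Sum>i\<le>j. t (of_nat (n ^ i)) (d i)) = (\<Sum>i\<le>Suc j. t (of_nat (n ^ i)) (d i))"
        by (simp add: d_def)
      also have "\<dots> = t (2 ^ Suc j) (\<Sum>i\<le>Suc j. t (of_nat (n ^ i)) (c i))
          - (\<Sum>i\<le>Suc j. t (of_nat ((2 * n) ^ i)) (c i))"
        unfolding scale_sum_right sum_subtractf[symmetric]
        by (rule sum.cong[OF refl]) (rule d_eq, simp)
      also have "\<dots> = 0"
        unfolding Suc.prems(1) by simp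
      finally show ?thesis .
    qed
    then have "d i = 0"
      using Suc.IH[of d] that by blast
    moreover have "(2::nat) ^ i < 2 ^ Suc j"
      using that by (intro power_strict_increasing) auto
    ultimately show ?thesis
      unfolding d_def by (metis torsion_free diff_is_0_eq not_less)
  qed
  show ?case
  proof (cases "i \<le> j")
    case False
    have "(\<Sum>i\<le>Suc j. t (of_nat (1 ^ i)) (c i)) = 0"
      using Suc.prems(1)[of 1] .
    then have "c (Suc j) = 0"
      by (simp add: zero_below)
    then show ?thesis
      using False Suc.prems(2) by (simp add: le_Suc_eq)
  qed (rule zero_below)
qed

text \<open>
  The binomial expansion of \<open>(\<delta>\<^sub>a + n \<delta>\<^sub>b)\<^sup>j\<close> as a polynomial in \<open>n\<close>. Only the linear coefficient is
  of interest; the constant one and the vanishing beyond degree \<open>j\<close> are what the induction on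
  \<open>j\<close> needs to determine it.
\<close>

lemma delta_pow_expand:
  assumes "module s" "module t" "additive D"
  shows "\<exists>c. c 1 = (\<lambda>x. t (of_nat j) ((delta s t a ^^ (j - 1)) (delta s t b D) x)) \<and>
    c 0 = (delta s t a ^^ j) D \<and> (\<forall>i>j. c i = (\<lambda>_. 0)) \<and>
    (\<forall>n. (delta s t (a + of_nat n * b) ^^ j) D = (\<lambda>x. \<Sum>i\<le>j. t (of_nat (n ^ i)) (c i x)))"
proof (induction j)
  case 0
  interpret t: module t by fact
  show ?case by (intro exI[of _ "\<lambda>i. if i = 0 then D else (\<lambda>_. 0)"]) auto
next
  case (Suc j)
  interpret s: module s by fact
  interpret t: module t by fact
  obtain c where c1: "c 1 = (\<lambda>x. t (of_nat j) ((delta s t a ^^ (j - 1)) (delta s t b D) x))"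
    and c0: "c 0 = (delta s t a ^^ j) D" and c_out: "\<And>i. i > j \<Longrightarrow> c i = (\<lambda>_. 0)"
    and c: "\<And>n. (delta s t (a + of_nat n * b) ^^ j) D = (\<lambda>x. \<Sum>i\<le>j. t (of_nat (n ^ i)) (c i x))"
    using Suc.IH by blast
  \<comment> \<open>Multiply the expansion by \<open>\<delta>\<^sub>a + n \<delta>\<^sub>b\<close> and collect powers of \<open>n\<close>.\<close>
  define d where "d i = (case i of 0 \<Rightarrow> delta s t a (c 0)
    | Suc i' \<Rightarrow> (\<lambda>x. delta s t a (c (Suc i')) x + delta s t b (c i') x))" for i
  have linear_in_a: "delta s t (a + of_nat n * b) E
      = (\<lambda>x. delta s t a E x + t (of_nat n) (delta s t b E x))" if "additive E" for n E
  proof -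
    interpret E: additive E by fact
    have nat: "E (s (of_nat m) x) = t (of_nat m) (E x)" for m x
      by (induction m) (simp_all add: E.zero E.add s.scale_left_distrib t.scale_left_distrib)
    have "E (s (of_nat n * b) x) = t (of_nat n) (E (s b x))" for x
      using nat[of n "s b x"] by simp
    then show ?thesis
      by (simp add: delta_def fun_eq_iff s.scale_left_distrib t.scale_left_distrib E.add
          t.scale_right_diff_distrib del: s.scale_scale)
  qed
  have "d 1 = (\<lambda>x. t (of_nat (Suc j)) ((delta s t a ^^ j) (delta s t b D) x))"
  proof -
    have "delta s t a (c 1) = (\<lambda>x. t (of_nat j) ((delta s t a ^^ j) (delta s t b D) x))"
    proof (cases j)
      case 0
      then show ?thesis
        using \<open>module t\<close> c_out[of 1] by simp
    next
      case (Suc j')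
      have "delta s t a (c 1)
          = (\<lambda>x. t (of_nat j) (delta s t a ((delta s t a ^^ (j - 1)) (delta s t b D)) x))"
        unfolding c1 by (rule delta_scale_operator[OF \<open>module t\<close>])
      then show ?thesis
        by (simp add: Suc)
    qed
    moreover have "delta s t b (c 0) = (delta s t a ^^ j) (delta s t b D)"
      unfolding c0 by (rule delta_pow_commute[OF assms(1,2)])
    ultimately show ?thesis
      by (simp add: d_def t.scale_left_distrib add.commute)
  qed
  moreover have "d 0 = (delta s t a ^^ Suc j) D"
    by (simp add: d_def c0)
  moreover have "d i = (\<lambda>_. 0)" if "i > Suc j" for i
    using that assms by (cases i) (auto simp: d_def c_out)
  moreover have "(delta s t (a + of_nat n * b) ^^ Suc j) D
      = (\<lambda>x. \<Sum>i\<le>Suc j. t (of_nat (n ^ i)) (d i x))" for n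
  proof -
    have "(delta s t (a + of_nat n * b) ^^ Suc j) D
        = delta s t (a + of_nat n * b) ((delta s t (a + of_nat n * b) ^^ j) D)"
      by simp
    also have "\<dots> = (\<lambda>x. (\<Sum>i\<le>j. t (of_nat (n ^ i)) (delta s t a (c i) x))
        + t (of_nat n) (\<Sum>i\<le>j. t (of_nat (n ^ i)) (delta s t b (c i) x)))"
      using assms
      by (simp only: linear_in_a additive_delta_pow)
        (simp only: c delta_sum_operator delta_scale_operator)
    also have "\<dots> = (\<lambda>x. \<Sum>i\<le>Suc j. t (of_nat (n ^ i)) (d i x))"
    proof
      fix x
      have "(\<Sum>i\<le>j. t (of_nat (n ^ i)) (delta s t a (c i) x))
          = (\<Sum>i\<le>Suc j. t (of_nat (n ^ i)) (delta s t a (c i) x))"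
        using assms by (simp add: c_out)
      also have "\<dots> = delta s t a (c 0) x
          + (\<Sum>i\<le>j. t (of_nat (n ^ Suc i)) (delta s t a (c (Suc i)) x))"
        by (subst sum.atMost_Suc_shift) simp
      finally show "(\<Sum>i\<le>j. t (of_nat (n ^ i)) (delta s t a (c i) x))
        + t (of_nat n) (\<Sum>i\<le>j. t (of_nat (n ^ i)) (delta s t b (c i) x))
        = (\<Sum>i\<le>Suc j. t (of_nat (n ^ i)) (d i x))"
        by (subst sum.atMost_Suc_shift)
          (simp add: d_def t.scale_sum_right t.scale_right_distrib sum.distrib)
    qed
    finally show ?thesis .
  qed
  ultimately show ?case
    by (intro exI[of _ d]) simp
qed

text \<open>
  Replacing \<open>a\<close> by \<open>a + n b\<close> for all \<open>n\<close> gives a polynomial identity, whose linear coefficient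
  is \<open>(j + 1) \<delta>\<^sub>a\<^sup>j \<delta>\<^sub>b D\<close>. This trades one of the equal factors for an arbitrary one.
\<close>

lemma delta_pow_polarize:
  assumes "module s" "module t" "additive D"
    and torsion_free: "\<And>n x. n \<noteq> 0 \<Longrightarrow> t (of_nat n) x = 0 \<Longrightarrow> x = 0"
    and vanish: "\<And>a. (delta s t a ^^ Suc j) D = (\<lambda>_. 0)"
  shows "(delta s t a ^^ j) (delta s t b D) = (\<lambda>_. 0)"
proof
  fix x
  obtain c where c1: "c 1 = (\<lambda>x. t (of_nat (Suc j)) ((delta s t a ^^ j) (delta s t b D) x))"
    and c: "\<And>n. (delta s t (a + of_nat n * b) ^^ Suc j) D
      = (\<lambda>x. \<Sum>i\<le>Suc j. t (of_nat (n ^ i)) (c i x))"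
    using delta_pow_expand[OF assms(1-3), where j = "Suc j" and a = a and b = b]
    unfolding diff_Suc_1 by blast
  have "(\<Sum>i\<le>Suc j. t (of_nat (n ^ i)) (c i x)) = 0" for n
    using fun_cong[OF c[of n], of x] unfolding vanish by simp
  then have "c 1 x = 0"
    using polynomial_identity_coeffs[OF \<open>module t\<close> torsion_free,
        where j = "Suc j" and c = "\<lambda>i. c i x" and i = 1] by auto
  then show "(delta s t a ^^ j) (delta s t b D) x = 0"
    unfolding c1 using torsion_free[of "Suc j"] by blast
qed

text \<open>
  Polarization: freeing the factors of \<open>\<delta>\<^sub>a\<^sup>k\<close> one at a time turns a condition on the diagonal into
  one on all \<open>k\<close>-tuples.
\<close>

lemma order_below_iff_delta_pow:
  assumes "module s" "module t" "additive D"
    and torsion_free: "\<And>n x. n \<noteq> 0 \<Longrightarrow> t (of_nat n) x = 0 \<Longrightarrow> x = 0"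
  shows "order_below s t k D \<longleftrightarrow> (\<forall>a. (delta s t a ^^ k) D = (\<lambda>_. 0))"
proof
  assume D: "order_below s t k D"
  show "\<forall>a. (delta s t a ^^ k) D = (\<lambda>_. 0)"
  proof
    fix a
    show "(delta s t a ^^ k) D = (\<lambda>_. 0)"
      using D[unfolded order_below_def, rule_format, of "replicate k a"] by (simp add: foldr_replicate)
  qed
next
  assume "\<forall>a. (delta s t a ^^ k) D = (\<lambda>_. 0)"
  then show "order_below s t k D"
    using \<open>additive D\<close>
  proof (induction k arbitrary: D)
    case (Suc k)
    have vanish: "(delta s t a ^^ Suc k) D = (\<lambda>_. 0)" for a
      using Suc.prems(1) by blast
    have "(delta s t a ^^ k) (delta s t b D) = (\<lambda>_. 0)" for a b
      using delta_pow_polarize[OF assms(1,2) Suc.prems(2) torsion_free vanish] .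
    then show ?case
      unfolding order_below_Suc using Suc.IH additive_delta[OF assms(1,2) Suc.prems(2)] by simp
  qed simp
qed
section \<open>The order of a graded operator on the total algebra\<close>

definition graded_order_below ::
    "('a::comm_ring_1 \<Rightarrow> 'p::ab_group_add \<Rightarrow> 'p) \<Rightarrow> nat \<Rightarrow> int \<Rightarrow> ('a \<times> 'p \<Rightarrow> 'a \<times> 'p) \<Rightarrow> bool"
  where "graded_order_below sm n g \<phi> \<longleftrightarrow>
    (\<forall>xs. length xs = n \<and> (\<forall>(i, a) \<in> set xs. a \<in> dgrade i) \<longrightarrow>
       gdeltas (dmult sm) (dmult sm) g xs \<phi> = (\<lambda>_. 0))"

lemma in_diolic_Diff_iff:
  "\<phi> \<in> diolic_Diff scA sm k g \<longleftrightarrow>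
    Vector_Spaces.linear (dscale scA sm) (dscale scA sm) \<phi> \<and>
    (\<forall>i. \<phi> ` dgrade i \<subseteq> dgrade (i + g)) \<and> graded_order_below sm (Suc k) g \<phi>"
  by (simp add: diolic_Diff_def graded_Diff_def graded_order_below_def)

lemma gdeltas_append:
  "gdeltas s t g (xs @ ys) \<phi> = gdeltas s t (g + sum_list (map fst ys)) xs (gdeltas s t g ys \<phi>)"
  by (induction xs) (auto simp: add_ac)

lemma graded_order_below_0 [simp]: "graded_order_below sm 0 g \<phi> \<longleftrightarrow> \<phi> = (\<lambda>_. 0)"
  by (simp add: graded_order_below_def)

lemma graded_order_below_Suc:
  fixes sm :: "'a::comm_ring_1 \<Rightarrow> 'p::ab_group_add \<Rightarrow> 'p"
  shows "graded_order_below sm (Suc n) g \<phi> \<longleftrightarrow>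
    (\<forall>i. \<forall>x\<in>dgrade i. graded_order_below sm n (g + i) (gdelta (dmult sm) (dmult sm) i g x \<phi>))"
proof
  assume \<phi>: "graded_order_below sm (Suc n) g \<phi>"
  show "\<forall>i. \<forall>x\<in>dgrade i. graded_order_below sm n (g + i) (gdelta (dmult sm) (dmult sm) i g x \<phi>)"
    unfolding graded_order_below_def
  proof (intro allI ballI impI)
    fix i and x :: "'a \<times> 'p" and xs :: "(int \<times> 'a \<times> 'p) list"
    assume "x \<in> dgrade i" "length xs = n \<and> (\<forall>(i, a) \<in> set xs. a \<in> dgrade i)"
    then have "gdeltas (dmult sm) (dmult sm) g (xs @ [(i, x)]) \<phi> = (\<lambda>_. 0)"
      using \<phi> unfolding graded_order_below_def by simp
    then show "gdeltas (dmult sm) (dmult sm) (g + i) xs (gdelta (dmult sm) (dmult sm) i g x \<phi>)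
        = (\<lambda>_. 0)"
      by (simp add: gdeltas_append)
  qed
next
  assume \<phi>: "\<forall>i. \<forall>x\<in>dgrade i.
    graded_order_below sm n (g + i) (gdelta (dmult sm) (dmult sm) i g x \<phi>)"
  show "graded_order_below sm (Suc n) g \<phi>"
    unfolding graded_order_below_def
  proof (intro allI impI)
    fix xs :: "(int \<times> 'a \<times> 'p) list"
    assume xs: "length xs = Suc n \<and> (\<forall>(i, a) \<in> set xs. a \<in> dgrade i)"
    then obtain ys i x where "xs = ys @ [(i, x)]" "length ys = n"
      by (auto simp: length_Suc_conv_rev)
    with xs \<phi> show "gdeltas (dmult sm) (dmult sm) g xs \<phi> = (\<lambda>_. 0)"
      by (simp add: graded_order_below_def gdeltas_append)
  qed
qed

text \<open>Degrees other than \<open>0\<close> and \<open>1\<close> contain only zero, but zero has every degree, hence the last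
  conjunct.\<close>

lemma ball_dgrade_iff:
  "(\<forall>i. \<forall>x\<in>dgrade i. Q i x) \<longleftrightarrow> (\<forall>a. Q 0 (a, 0)) \<and> (\<forall>p. Q 1 (0, p)) \<and> (\<forall>i. Q i 0)"
proof safe
  fix i and a :: 'a and p :: 'b
  assume Q: "\<forall>a. Q 0 (a, 0)" "\<forall>p. Q 1 (0, p)" "\<forall>i. Q i 0" and "(a, p) \<in> dgrade i"
  then show "Q i (a, p)"
    by (cases "i = 0"; cases "i = 1") (auto simp: dgrade_def zero_prod_def)
qed (auto simp: dgrade_def zero_prod_def)

definition degree_one_map :: "('a \<Rightarrow> 'p) \<Rightarrow> 'a \<times> 'p \<Rightarrow> 'a::zero \<times> 'p"
  where "degree_one_map F x = (0, F (fst x))"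

definition degree_minus_one_map :: "('p \<Rightarrow> 'a) \<Rightarrow> 'a \<times> 'p \<Rightarrow> 'a \<times> 'p::zero"
  where "degree_minus_one_map X x = (X (snd x), 0)"

lemma degree_one_map_0 [simp]: "F 0 = 0 \<Longrightarrow> degree_one_map F 0 = 0"
  by (simp add: degree_one_map_def zero_prod_def)

lemma degree_one_map_eq_0_iff [simp]: "degree_one_map F = (\<lambda>_. 0) \<longleftrightarrow> F = (\<lambda>_. 0)"
  by (auto simp: degree_one_map_def fun_eq_iff zero_prod_def)

lemma degree_minus_one_map_0 [simp]: "X 0 = 0 \<Longrightarrow> degree_minus_one_map X 0 = 0"
  by (simp add: degree_minus_one_map_def zero_prod_def)

lemma degree_minus_one_map_eq_0_iff [simp]:
  "degree_minus_one_map X = (\<lambda>_. 0) \<longleftrightarrow> X = (\<lambda>_. 0)"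
  by (auto simp: degree_minus_one_map_def fun_eq_iff zero_prod_def)

lemma map_prod_0 [simp]: "D 0 = 0 \<Longrightarrow> E 0 = 0 \<Longrightarrow> map_prod D E 0 = 0"
  by (simp add: zero_prod_def)

lemma map_prod_eq_0_iff [simp]:
  "map_prod D E = (\<lambda>_. 0) \<longleftrightarrow> D = (\<lambda>_. 0) \<and> E = (\<lambda>_. 0)"
  by (auto simp: fun_eq_iff zero_prod_def)

text \<open>
  The failure of the pair \<open>(D, E)\<close> to respect the action of \<open>A\<close> on \<open>p\<close>, as a function of the
  element of \<open>A\<close>. It is the restriction to \<open>A\<close> of the graded commutator of \<open>D \<oplus> E\<close> with \<open>p\<close>.
\<close>

definition action_defect :: "('a \<Rightarrow> 'p \<Rightarrow> 'p::ab_group_add) \<Rightarrow> ('a \<Rightarrow> 'a) \<Rightarrow> ('p \<Rightarrow> 'p) \<Rightarrow> 'p \<Rightarrow> 'a \<Rightarrow> 'p"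
  where "action_defect sm D E p b = sm (D b) p - E (sm b p)"

lemma module_mult: "module ((*) :: 'a::comm_ring_1 \<Rightarrow> 'a \<Rightarrow> 'a)"
  by unfold_locales (simp_all add: algebra_simps)

context module
begin

lemma dmult_degree_0: "dmult scale (a, 0) x = (a * fst x, scale a (snd x))"
  by (simp add: dmult_def)

lemma dmult_degree_1: "dmult scale (0, p) x = (0, scale (fst x) p)"
  by (simp add: dmult_def)

lemma dmult_zero: "dmult scale 0 x = 0"
  by (simp add: dmult_def zero_prod_def)

lemma graded_order_below_zero_operator [simp]: "graded_order_below scale n g (\<lambda>_. 0)"
proof (induction n arbitrary: g)
  case (Suc n)
  have "gdelta (dmult scale) (dmult scale) i g x (\<lambda>_. 0) = (\<lambda>_. 0)" for i x
    by (simp add: gdelta_def dmult_def zero_prod_def)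
  then show ?case
    by (simp add: graded_order_below_Suc Suc)
qed simp

lemma graded_order_below_Suc_iff:
  assumes "\<phi> 0 = 0"
  shows "graded_order_below scale (Suc n) g \<phi> \<longleftrightarrow>
    (\<forall>a. graded_order_below scale n g (gdelta (dmult scale) (dmult scale) 0 g (a, 0) \<phi>)) \<and>
    (\<forall>p. graded_order_below scale n (g + 1) (gdelta (dmult scale) (dmult scale) 1 g (0, p) \<phi>))"
proof -
  have "gdelta (dmult scale) (dmult scale) i g 0 \<phi> = (\<lambda>_. 0)" for i
    using assms by (simp add: gdelta_def dmult_zero fun_eq_iff)
  then show ?thesis
    unfolding graded_order_below_Suc ball_dgrade_iff by simp
qed

lemma graded_order_below_mono:
  "graded_order_below scale n g \<phi> \<Longrightarrow> n \<le> m \<Longrightarrow> graded_order_below scale m g \<phi>"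
proof (induction n arbitrary: m g \<phi>)
  case (Suc n)
  then obtain m' where m: "m = Suc m'" "n \<le> m'"
    by (cases m) auto
  with Suc show ?case
    unfolding m(1) graded_order_below_Suc by blast
qed simp

text \<open>
  Elements of \<open>P\<close> kill a degree one map from either side: \<open>P \<cdot> P = 0\<close>, and \<open>P\<close> is sent to zero. So
  only commutators with elements of \<open>A\<close> count.
\<close>

lemma graded_order_below_degree_one_map_iff:
  "additive F \<Longrightarrow> graded_order_below scale n g (degree_one_map F) \<longleftrightarrow> order_below (*) scale n F"
proof (induction n arbitrary: g F)
  case 0
  then show ?case
    by simp
next
  case (Suc n)
  interpret F: additive F by fact
  have "gdelta (dmult scale) (dmult scale) 0 g (a, 0) (degree_one_map F)
      = degree_one_map (delta (*) scale a F)" for a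
    by (simp add: gdelta_def dmult_degree_0 degree_one_map_def delta_def fun_eq_iff)
  moreover have "gdelta (dmult scale) (dmult scale) 1 g (0, p) (degree_one_map F) = (\<lambda>_. 0)" for p
    by (simp add: gdelta_def dmult_degree_1 degree_one_map_def F.zero fun_eq_iff prod_eq_iff)
  moreover have "additive (delta (*) scale a F)" for a
    using additive_delta[OF module_mult module_axioms Suc.prems] .
  ultimately show ?case
    using F.zero
    by (simp add: graded_order_below_Suc_iff order_below_Suc Suc.IH)
qed

lemma delta_action_defect:
  "delta (*) scale a (action_defect scale D E p)
    = action_defect scale (delta (*) (*) a D) (delta scale scale a E) p"
  by (simp add: delta_def action_defect_def fun_eq_iff scale_right_diff_distrib
      scale_left_diff_distrib)

lemma delta_pow_action_defect:
  "(delta (*) scale a ^^ k) (action_defect scale D E p)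
    = action_defect scale ((delta (*) (*) a ^^ k) D) ((delta scale scale a ^^ k) E) p"
  by (induction k) (simp_all add: delta_action_defect)

lemma additive_action_defect:
  assumes "additive D" "additive E"
  shows "additive (action_defect scale D E p)"
proof -
  interpret D: additive D by fact
  interpret E: additive E by fact
  show ?thesis
    by unfold_locales (simp add: action_defect_def D.add E.add scale_left_distrib)
qed

lemma gdelta_0_map_prod:
  "gdelta (dmult scale) (dmult scale) 0 g (a, 0) (map_prod D E)
    = map_prod (delta (*) (*) a D) (delta scale scale a E)"
  by (auto simp: gdelta_def dmult_degree_0 delta_def fun_eq_iff)

lemma gdelta_1_map_prod:
  "D 0 = 0 \<Longrightarrow> gdelta (dmult scale) (dmult scale) 1 0 (0, p) (map_prod D E)
    = degree_one_map (action_defect scale D E p)"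
  by (auto simp: gdelta_def dmult_degree_1 degree_one_map_def action_defect_def fun_eq_iff)

text \<open>
  A list of commutators with two elements of \<open>P\<close> annihilates \<open>D \<oplus> E\<close>. Lists without any such element
  give the first two conditions. Lists with exactly one give the third, wherever that element
  stands, since passing to the action defect commutes with \<open>\<delta>\<^sub>a\<close>.
\<close>

lemma graded_order_below_map_prod_iff:
  "additive D \<Longrightarrow> additive E \<Longrightarrow>
    graded_order_below scale (Suc n) 0 (map_prod D E) \<longleftrightarrow>
      order_below (*) (*) (Suc n) D \<and> order_below scale scale (Suc n) E \<and>
      (\<forall>p. order_below (*) scale n (action_defect scale D E p))"
proof (induction n arbitrary: D E)
  case (0 D E)
  interpret D: additive D by fact
  interpret E: additive E by fact
  show ?case
    by (simp add: graded_order_below_Suc_iff order_below_Suc D.zero E.zero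
        gdelta_0_map_prod gdelta_1_map_prod) blast
next
  case (Suc n D E)
  interpret D: additive D by fact
  interpret E: additive E by fact
  have "map_prod D E 0 = 0"
    by (simp add: D.zero E.zero)
  then have "graded_order_below scale (Suc (Suc n)) 0 (map_prod D E) \<longleftrightarrow>
      (\<forall>a. graded_order_below scale (Suc n) 0
        (map_prod (delta (*) (*) a D) (delta scale scale a E))) \<and>
      (\<forall>p. order_below (*) scale (Suc n) (action_defect scale D E p))"
    using Suc.prems
    by (subst graded_order_below_Suc_iff)
      (simp_all add: gdelta_0_map_prod gdelta_1_map_prod D.zero
        graded_order_below_degree_one_map_iff additive_action_defect)
  also have "\<dots> \<longleftrightarrow> (\<forall>a. order_below (*) (*) (Suc n) (delta (*) (*) a D) \<and>
      order_below scale scale (Suc n) (delta scale scale a E) \<and>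
      (\<forall>p. order_below (*) scale n (delta (*) scale a (action_defect scale D E p)))) \<and>
      (\<forall>p. order_below (*) scale (Suc n) (action_defect scale D E p))"
    using Suc.prems
    by (simp add: delta_action_defect Suc.IH additive_delta module_mult module_axioms)
  also have "\<dots> \<longleftrightarrow> order_below (*) (*) (Suc (Suc n)) D \<and> order_below scale scale (Suc (Suc n)) E \<and>
      (\<forall>p. order_below (*) scale (Suc n) (action_defect scale D E p))"
    unfolding order_below_Suc[of _ _ "Suc n"] order_below_Suc[of "(*)" scale n] by blast
  finally show ?case .
qed

lemma order_below_if_degree_minus_one_map:
  "additive X \<Longrightarrow> graded_order_below scale n g (degree_minus_one_map X) \<Longrightarrow> order_below scale (*) n X"
proof (induction n arbitrary: X)
  case 0
  then show ?case
    by simp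
next
  case (Suc n)
  interpret X: additive X by fact
  have "gdelta (dmult scale) (dmult scale) 0 g (a, 0) (degree_minus_one_map X)
      = degree_minus_one_map (delta scale (*) a X)" for a
    by (simp add: gdelta_def dmult_degree_0 degree_minus_one_map_def delta_def
          fun_eq_iff)
  then have "graded_order_below scale n g (degree_minus_one_map (delta scale (*) a X))" for a
    using Suc.prems(2) X.zero
    by (simp add: graded_order_below_Suc_iff)
  then show ?case
    unfolding order_below_Suc
    using Suc.IH additive_delta[OF module_axioms module_mult Suc.prems(1)] by blast
qed

text \<open>
  The symmetry condition makes the graded commutator of \<open>X\<close> with \<open>p\<close> the multiplication by the
  scalar \<open>X p\<close> on the whole algebra. The sign rule contributes a plus here, because \<open>X\<close> and \<open>p\<close>
  are both odd.
\<close>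

lemma graded_order_below_functional:
  assumes X: "module_hom scale (*) X" and sym: "\<And>p q. scale (X p) q = scale (X q) p"
  shows "graded_order_below scale 2 (- 1) (degree_minus_one_map X)"
proof -
  interpret X: module_hom scale "(*)" X by fact
  have "gdelta (dmult scale) (dmult scale) 0 (- 1) (a, 0) (degree_minus_one_map X) = (\<lambda>_. 0)" for a
    by (simp add: gdelta_def dmult_degree_0 degree_minus_one_map_def X.scale fun_eq_iff
        prod_eq_iff)
  moreover have "graded_order_below scale (Suc 0) 0
      (gdelta (dmult scale) (dmult scale) 1 (- 1) (0, p) (degree_minus_one_map X))" for p
  proof -
    define D where "D b = X p * b" for b
    define E where "E q = scale (X p) q" for q
    have "gdelta (dmult scale) (dmult scale) 1 (- 1) (0, p) (degree_minus_one_map X) = map_prod D E"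
      by (auto simp: gdelta_def dmult_degree_1 degree_minus_one_map_def X.scale D_def E_def
          fun_eq_iff sym[of p] mult.commute)
    moreover have "additive D"
      by unfold_locales (simp add: D_def distrib_left)
    moreover have "additive E"
      by unfold_locales (simp add: E_def scale_right_distrib)
    moreover have "order_below (*) (*) (Suc 0) D"
      using order_below_multiplication[OF module_mult, of "X p"] by (simp add: D_def[abs_def])
    moreover have "order_below scale scale (Suc 0) E"
      using order_below_multiplication[OF module_axioms, of "X p"] by (simp add: E_def[abs_def])
    moreover have "action_defect scale D E q = (\<lambda>_. 0)" for q
      by (simp add: action_defect_def D_def E_def fun_eq_iff)
    ultimately show ?thesis
      using graded_order_below_map_prod_iff[of D E 0] by simp
  qed
  ultimately show ?thesis
    unfolding numeral_2_eq_2
    by (subst graded_order_below_Suc_iff) (simp_all add: X.zero)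
qed

end

section \<open>Linearity over the ground field\<close>

context diolic_algebra
begin

lemma of_nat_eq_scA: "of_nat n = scA (of_nat n) 1"
  by (induction n) (simp_all add: scale_left_distrib)

lemma scA_eq_mult: "scA c a = scA c 1 * a"
  using scA_mult[of c 1 a] by simp

lemma torsion_free:
  assumes "n \<noteq> 0" "sm (of_nat n) x = 0"
  shows "x = 0"
proof -
  have "scA (inverse (of_nat n)) 1 * of_nat n = scA (inverse (of_nat n)) (of_nat n)"
    by (rule scA_eq_mult[symmetric])
  also have "\<dots> = 1"
    using assms(1) by (subst of_nat_eq_scA) simp
  finally have "x = sm (scA (inverse (of_nat n)) 1) (sm (of_nat n) x)"
    by simp
  then show ?thesis
    using assms(2) by simp
qed

lemma vector_space_base_scale:
  assumes "module act"
  shows "vector_space (base_scale scA act)"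
proof -
  interpret act: module act by fact
  show ?thesis
    by unfold_locales
      (simp_all add: base_scale_def act.scale_right_distrib act.scale_left_distrib
        scale_left_distrib scA_eq_mult[of _ "scA _ 1", symmetric])
qed

lemma vector_space_dscale: "vector_space (dscale scA sm)"
proof -
  interpret B: vector_space "base_scale scA sm"
    by (rule vector_space_base_scale[OF P.module_axioms])
  show ?thesis
    by unfold_locales
      (simp_all add: dscale_def prod_eq_iff scale_right_distrib scale_left_distrib
        B.scale_right_distrib B.scale_left_distrib)
qed

lemma base_scale_mult: "base_scale scA (*) = scA"
  by (simp add: base_scale_def fun_eq_iff scA_eq_mult[symmetric])

lemma linear_base_iff:
  assumes "module s" "module t"
  shows "Vector_Spaces.linear (base_scale scA s) (base_scale scA t) D \<longleftrightarrow>
    (\<forall>x y. D (x + y) = D x + D y) \<and> (\<forall>c x. D (base_scale scA s c x) = base_scale scA t c (D x))"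
  by (simp add: Vector_Spaces.linear_iff vector_space_base_scale assms)

lemma linear_dscale_iff:
  "Vector_Spaces.linear (dscale scA sm) (dscale scA sm) \<phi> \<longleftrightarrow>
    (\<forall>x y. \<phi> (x + y) = \<phi> x + \<phi> y) \<and> (\<forall>c x. \<phi> (dscale scA sm c x) = dscale scA sm c (\<phi> x))"
  by (simp add: Vector_Spaces.linear_iff vector_space_dscale)

lemma additive_of_Diff: "D \<in> Diff scA s t k \<Longrightarrow> additive D"
  by (simp add: in_Diff_iff Vector_Spaces.linear_iff additive_def)

lemma linear_map_prod_iff:
  "Vector_Spaces.linear (dscale scA sm) (dscale scA sm) (map_prod D E) \<longleftrightarrow>
    Vector_Spaces.linear (base_scale scA (*)) (base_scale scA (*)) D \<and>
    Vector_Spaces.linear (base_scale scA sm) (base_scale scA sm) E"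
  unfolding linear_dscale_iff linear_base_iff[OF module_mult module_mult]
    linear_base_iff[OF P.module_axioms P.module_axioms]
  by (auto simp: dscale_def base_scale_mult)

lemma linear_degree_one_map_iff:
  "Vector_Spaces.linear (dscale scA sm) (dscale scA sm) (degree_one_map F) \<longleftrightarrow>
    Vector_Spaces.linear (base_scale scA (*)) (base_scale scA sm) F"
  unfolding linear_dscale_iff linear_base_iff[OF module_mult P.module_axioms]
  by (auto simp: dscale_def base_scale_mult degree_one_map_def)

lemma linear_degree_minus_one_map_iff:
  "Vector_Spaces.linear (dscale scA sm) (dscale scA sm) (degree_minus_one_map X) \<longleftrightarrow>
    Vector_Spaces.linear (base_scale scA sm) (base_scale scA (*)) X"
  unfolding linear_dscale_iff linear_base_iff[OF P.module_axioms module_mult]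
  by (auto simp: dscale_def base_scale_mult degree_minus_one_map_def base_scale_def)

section \<open>Operators of degree zero\<close>

text \<open>
  After polarization both sides speak about \<open>\<delta>\<^sub>a\<^sup>k\<close>. Since \<open>D\<close> has order \<open>\<le> k\<close>, \<open>\<delta>\<^sub>a\<^sup>k D\<close> is multiplication
  by its value \<open>f\<close> at \<open>1\<close>, and the action defect, evaluated at \<open>1\<close>, says that \<open>\<delta>\<^sub>a\<^sup>k E\<close> is
  multiplication by \<open>f\<close> too.
\<close>

lemma same_symbol_iff_order_below:
  assumes D: "D \<in> Diff scA (*) (*) k" and E: "E \<in> Diff scA sm sm k"
  shows "same_symbol sm k D E \<longleftrightarrow> (\<forall>p. order_below (*) sm k (action_defect sm D E p))"
proof -
  have additive: "additive (action_defect sm D E p)" for p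
    by (rule P.additive_action_defect[OF additive_of_Diff[OF D] additive_of_Diff[OF E]])
  have symbol_D: "(delta (*) (*) a ^^ k) D b = (delta (*) (*) a ^^ k) D 1 * b" for a b
  proof -
    \<comment> \<open>One more commutator, with \<open>b\<close>, kills \<open>\<delta>\<^sub>a\<^sup>k D\<close>, which is therefore linear over \<open>A\<close>.\<close>
    have "foldr (delta (*) (*)) (b # replicate k a) D = (\<lambda>_. 0)"
      using D by (simp add: in_Diff_iff order_below_def del: foldr.simps)
    from fun_cong[OF this, of 1] show ?thesis
      by (simp add: foldr_replicate delta_def mult.commute)
  qed
  have defect_zero_iff: "(\<forall>p. action_defect sm ((delta (*) (*) a ^^ k) D) ((delta sm sm a ^^ k) E) p
        = (\<lambda>_. 0)) \<longleftrightarrow>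
      (\<exists>f. (delta (*) (*) a ^^ k) D = (\<lambda>b. f * b) \<and> (delta sm sm a ^^ k) E = (\<lambda>p. sm f p))"
    (is "?L \<longleftrightarrow> ?R") for a
  proof
    assume L: ?L
    have "(delta sm sm a ^^ k) E p = sm ((delta (*) (*) a ^^ k) D 1) p" for p
      using fun_cong[OF spec[OF L, of p], of 1] by (simp add: action_defect_def)
    then show ?R
      using symbol_D by blast
  next
    assume ?R
    then show ?L
      by (auto simp: action_defect_def fun_eq_iff)
  qed
  have "(\<forall>p. order_below (*) sm k (action_defect sm D E p)) \<longleftrightarrow>
      (\<forall>p a. (delta (*) sm a ^^ k) (action_defect sm D E p) = (\<lambda>_. 0))"
    by (intro all_cong1 order_below_iff_delta_pow module_mult P.module_axioms additive)
      (rule torsion_free)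
  also have "\<dots> \<longleftrightarrow> same_symbol sm k D E"
    unfolding same_symbol_def P.delta_pow_action_defect defect_zero_iff[symmetric] by blast
  finally show ?thesis ..
qed

lemma diolic_Diff_0_eq:
  "diolic_Diff scA sm k 0 = (\<lambda>(D, E). map_prod D E) `
    {(D, E). D \<in> Diff scA (*) (*) k \<and> E \<in> Diff scA sm sm k \<and> same_symbol sm k D E}"
proof (intro equalityI subsetI)
  fix \<phi> assume \<phi>: "\<phi> \<in> diolic_Diff scA sm k 0"
  define D where "D a = fst (\<phi> (a, 0))" for a
  define E where "E p = snd (\<phi> (0, p))" for p
  have lin: "Vector_Spaces.linear (dscale scA sm) (dscale scA sm) \<phi>"
    and grade: "\<phi> ` dgrade i \<subseteq> dgrade (i + 0)" for i
    using \<phi> unfolding in_diolic_Diff_iff by blast+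
  have "\<phi> (a, p) = map_prod D E (a, p)" for a p
  proof -
    have "\<phi> (a, p) = \<phi> (a, 0) + \<phi> (0, p)"
      using lin[unfolded linear_dscale_iff, THEN conjunct1, rule_format, of "(a, 0)" "(0, p)"] by simp
    moreover have "snd (\<phi> (a, 0)) = 0"
      using grade[of 0] by (auto simp: dgrade_def image_subset_iff mem_Times_iff)
    moreover have "fst (\<phi> (0, p)) = 0"
      using grade[of 1] by (auto simp: dgrade_def image_subset_iff mem_Times_iff)
    ultimately show ?thesis
      by (simp add: D_def E_def prod_eq_iff)
  qed
  then have eq: "\<phi> = map_prod D E"
    by (auto simp: fun_eq_iff)
  with lin have lin': "Vector_Spaces.linear (base_scale scA (*)) (base_scale scA (*)) D"
      "Vector_Spaces.linear (base_scale scA sm) (base_scale scA sm) E"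
    by (simp_all add: linear_map_prod_iff)
  then have "additive D" "additive E"
    by (simp_all add: Vector_Spaces.linear_iff additive_def)
  then have "D \<in> Diff scA (*) (*) k" "E \<in> Diff scA sm sm k" "same_symbol sm k D E"
    using \<phi> lin' same_symbol_iff_order_below[of D k E]
    by (simp_all add: in_diolic_Diff_iff in_Diff_iff eq P.graded_order_below_map_prod_iff)
  then show "\<phi> \<in> (\<lambda>(D, E). map_prod D E) `
      {(D, E). D \<in> Diff scA (*) (*) k \<and> E \<in> Diff scA sm sm k \<and> same_symbol sm k D E}"
    using eq by blast
next
  fix \<phi> assume "\<phi> \<in> (\<lambda>(D, E). map_prod D E) `
      {(D, E). D \<in> Diff scA (*) (*) k \<and> E \<in> Diff scA sm sm k \<and> same_symbol sm k D E}"
  then obtain D E where eq: "\<phi> = map_prod D E" and DE: "D \<in> Diff scA (*) (*) k"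
      "E \<in> Diff scA sm sm k" "same_symbol sm k D E"
    by auto
  interpret D: additive D by (rule additive_of_Diff[OF DE(1)])
  interpret E: additive E by (rule additive_of_Diff[OF DE(2)])
  have "\<forall>i. \<phi> ` dgrade i \<subseteq> dgrade (i + 0)"
    by (auto simp: dgrade_def eq D.zero E.zero zero_prod_def)
  moreover have "graded_order_below sm (Suc k) 0 \<phi>"
    using DE same_symbol_iff_order_below[OF DE(1,2)] D.additive_axioms E.additive_axioms
    by (simp add: in_Diff_iff eq P.graded_order_below_map_prod_iff)
  ultimately show "\<phi> \<in> diolic_Diff scA sm k 0"
    using DE by (simp add: in_diolic_Diff_iff in_Diff_iff eq linear_map_prod_iff)
qed

section \<open>Operators of degree one\<close>

lemma diolic_Diff_1_eq: "diolic_Diff scA sm k 1 = degree_one_map ` Diff scA (*) sm k"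
proof (intro equalityI subsetI)
  fix \<phi> assume \<phi>: "\<phi> \<in> diolic_Diff scA sm k 1"
  define F where "F a = snd (\<phi> (a, 0))" for a
  have lin: "Vector_Spaces.linear (dscale scA sm) (dscale scA sm) \<phi>"
    and grade: "\<phi> ` dgrade i \<subseteq> dgrade (i + 1)" for i
    using \<phi> unfolding in_diolic_Diff_iff by blast+
  have "\<phi> (a, p) = degree_one_map F (a, p)" for a p
  proof -
    have "\<phi> (a, p) = \<phi> (a, 0) + \<phi> (0, p)"
      using lin[unfolded linear_dscale_iff, THEN conjunct1, rule_format, of "(a, 0)" "(0, p)"] by simp
    moreover have "fst (\<phi> (a, 0)) = 0"
      using grade[of 0] by (auto simp: dgrade_def image_subset_iff mem_Times_iff)
    moreover have "\<phi> (0, p) = 0"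
      using grade[of 1] by (auto simp: dgrade_def image_subset_iff mem_Times_iff)
    ultimately show ?thesis
      by (simp add: F_def degree_one_map_def prod_eq_iff)
  qed
  then have eq: "\<phi> = degree_one_map F"
    by (auto simp: fun_eq_iff)
  with lin have lin': "Vector_Spaces.linear (base_scale scA (*)) (base_scale scA sm) F"
    by (simp add: linear_degree_one_map_iff)
  then have "additive F"
    by (simp add: Vector_Spaces.linear_iff additive_def)
  then have "F \<in> Diff scA (*) sm k"
    using \<phi> lin'
    by (simp add: in_diolic_Diff_iff in_Diff_iff eq P.graded_order_below_degree_one_map_iff)
  then show "\<phi> \<in> degree_one_map ` Diff scA (*) sm k"
    using eq by blast
next
  fix \<phi> assume "\<phi> \<in> degree_one_map ` Diff scA (*) sm k"
  then obtain F where eq: "\<phi> = degree_one_map F" and F: "F \<in> Diff scA (*) sm k"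
    by blast
  interpret F: additive F by (rule additive_of_Diff[OF F])
  have "\<forall>i. \<phi> ` dgrade i \<subseteq> dgrade (i + 1)"
    by (auto simp: dgrade_def eq degree_one_map_def F.zero zero_prod_def)
  then show "\<phi> \<in> diolic_Diff scA sm k 1"
    using F F.additive_axioms
    by (simp add: in_diolic_Diff_iff in_Diff_iff eq linear_degree_one_map_iff
        P.graded_order_below_degree_one_map_iff)
qed

lemma module_operators:
  "module (\<lambda>a D (b :: 'b). sm a (D b))"
  by unfold_locales (simp_all add: fun_eq_iff P.scale_right_distrib P.scale_left_distrib)

lemma module_total_operators:
  "module (\<lambda>a \<phi> (x :: 'b). dmult sm (a, 0) (\<phi> x))"
  by unfold_locales
    (simp_all add: fun_eq_iff P.dmult_degree_0 prod_eq_iff P.scale_right_distrib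
      P.scale_left_distrib algebra_simps)

lemma subspace_Diff: "module.subspace (\<lambda>a D b. sm a (D b)) (Diff scA (*) sm k)"
proof -
  interpret M: module "\<lambda>a D (b :: 'a). sm a (D b)"
    by (rule module_operators)
  interpret B: vector_space "base_scale scA sm"
    by (rule vector_space_base_scale[OF P.module_axioms])
  show ?thesis
  proof (rule M.subspaceI)
    show "0 \<in> Diff scA (*) sm k"
      by (simp add: in_Diff_iff zero_fun_def linear_base_iff module_mult P.module_axioms)
  next
    fix D E assume "D \<in> Diff scA (*) sm k" "E \<in> Diff scA (*) sm k"
    then show "D + E \<in> Diff scA (*) sm k"
      by (simp add: in_Diff_iff plus_fun_def linear_base_iff module_mult P.module_axioms
          order_below_add B.scale_right_distrib)
  next
    fix a D assume "D \<in> Diff scA (*) sm k"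
    then show "(\<lambda>b. sm a (D b)) \<in> Diff scA (*) sm k"
      by (simp add: in_Diff_iff linear_base_iff module_mult P.module_axioms
          order_below_scale P.scale_right_distrib) (simp add: base_scale_def mult.commute)
  qed
qed

lemma submodule_iso_diolic_Diff_1:
  "submodule_iso (\<lambda>a \<phi> x. dmult sm (a, 0) (\<phi> x)) (diolic_Diff scA sm k 1)
     (\<lambda>a D b. sm a (D b)) (Diff scA (*) sm k) (\<lambda>\<phi> a. snd (\<phi> (a, 0)))"
proof -
  interpret M: module "\<lambda>a \<phi> (x :: 'a \<times> 'p). dmult sm (a, 0) (\<phi> x)"
    by (rule module_total_operators)
  interpret N: module "\<lambda>a D (b :: 'a). sm a (D b)"
    by (rule module_operators)
  interpret embed: module_hom "\<lambda>a D (b :: 'a). sm a (D b)"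
      "\<lambda>a \<phi> (x :: 'a \<times> 'p). dmult sm (a, 0) (\<phi> x)" degree_one_map
    by unfold_locales (simp_all add: degree_one_map_def fun_eq_iff P.dmult_degree_0)
  have inverse: "(\<lambda>a. snd (degree_one_map F (a, 0))) = F" for F :: "'a \<Rightarrow> 'p"
    by (simp add: degree_one_map_def)
  have "bij_betw (\<lambda>\<phi> a. snd (\<phi> (a, 0))) (degree_one_map ` Diff scA (*) sm k) (Diff scA (*) sm k)"
    by (rule bij_betw_byWitness[where f' = degree_one_map]) (auto simp: inverse)
  moreover have "M.subspace (degree_one_map ` Diff scA (*) sm k)"
    by (rule embed.subspace_image[OF subspace_Diff])
  ultimately show ?thesis
    unfolding submodule_iso_def diolic_Diff_1_eq
    using M.module_axioms N.module_axioms subspace_Diff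
    by (simp add: fun_eq_iff P.dmult_degree_0)
qed

section \<open>Operators of degree minus one\<close>

text \<open>
  In contrast to degree one, an ordinary operator \<open>P \<rightarrow> A\<close> need not extend to a graded one: the
  commutators with elements of \<open>P\<close> impose further conditions.
\<close>

lemma diolic_Diff_minus_1_subset:
  "diolic_Diff scA sm k (- 1) \<subseteq> degree_minus_one_map ` Diff scA sm (*) k"
proof
  fix \<phi> assume \<phi>: "\<phi> \<in> diolic_Diff scA sm k (- 1)"
  define X where "X p = fst (\<phi> (0, p))" for p
  have lin: "Vector_Spaces.linear (dscale scA sm) (dscale scA sm) \<phi>"
    and grade: "\<phi> ` dgrade i \<subseteq> dgrade (i + - 1)" for i
    using \<phi> unfolding in_diolic_Diff_iff by blast+
  have "\<phi> (a, p) = degree_minus_one_map X (a, p)" for a p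
  proof -
    have "\<phi> (a, p) = \<phi> (a, 0) + \<phi> (0, p)"
      using lin[unfolded linear_dscale_iff, THEN conjunct1, rule_format, of "(a, 0)" "(0, p)"] by simp
    moreover have "\<phi> (a, 0) = 0"
      using grade[of 0] by (auto simp: dgrade_def image_subset_iff mem_Times_iff)
    moreover have "snd (\<phi> (0, p)) = 0"
      using grade[of 1] by (auto simp: dgrade_def image_subset_iff mem_Times_iff)
    ultimately show ?thesis
      by (simp add: X_def degree_minus_one_map_def prod_eq_iff)
  qed
  then have eq: "\<phi> = degree_minus_one_map X"
    by (auto simp: fun_eq_iff)
  with lin have lin': "Vector_Spaces.linear (base_scale scA sm) (base_scale scA (*)) X"
    by (simp add: linear_degree_minus_one_map_iff)
  then have "additive X"
    by (simp add: Vector_Spaces.linear_iff additive_def)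
  moreover have "graded_order_below sm (Suc k) (- 1) (degree_minus_one_map X)"
    using \<phi> by (simp add: in_diolic_Diff_iff eq)
  ultimately have "X \<in> Diff scA sm (*) k"
    using lin' P.order_below_if_degree_minus_one_map by (auto simp: in_Diff_iff)
  then show "\<phi> \<in> degree_minus_one_map ` Diff scA sm (*) k"
    using eq by blast
qed

lemma symmetric_functional_in_diolic_Diff:
  assumes X: "module_hom sm (*) X" and sym: "\<And>p q. sm (X p) q = sm (X q) p" and "k \<ge> 1"
  shows "degree_minus_one_map X \<in> diolic_Diff scA sm k (- 1)"
proof -
  interpret X: module_hom sm "(*)" X by fact
  have "graded_order_below sm (Suc k) (- 1) (degree_minus_one_map X)"
    by (rule P.graded_order_below_mono[OF P.graded_order_below_functional[OF X sym]])
      (use \<open>k \<ge> 1\<close> in simp)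
  moreover have "Vector_Spaces.linear (base_scale scA sm) (base_scale scA (*)) X"
    by (simp add: linear_base_iff P.module_axioms module_mult X.add base_scale_def X.scale)
  moreover have "\<forall>i. degree_minus_one_map X ` dgrade i \<subseteq> dgrade (i + - 1)"
    by (auto simp: dgrade_def degree_minus_one_map_def zero_prod_def)
  ultimately show ?thesis
    by (simp add: in_diolic_Diff_iff linear_degree_minus_one_map_iff)
qed

end

section \<open>Prime ideals and modules of rank one\<close>

text \<open>An ideal maximal among the proper ones above \<open>J\<close> is prime.\<close>

lemma proper_ideal_in_prime_ideal:
  fixes J :: "'a::comm_ring_1 set"
  assumes J: "module.subspace (*) J" "1 \<notin> J"
  shows "\<exists>I. prime_ideal I \<and> J \<subseteq> I"
proof -
  interpret R: module "(*) :: 'a \<Rightarrow> 'a \<Rightarrow> 'a" by (rule module_mult)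
  define \<A> where "\<A> = {I. R.subspace I \<and> J \<subseteq> I \<and> 1 \<notin> I}"
  have "\<exists>M\<in>\<A>. \<forall>I\<in>\<A>. M \<subseteq> I \<longrightarrow> I = M"
  proof (rule subset_Zorn_nonempty)
    show "\<A> \<noteq> {}"
      using J by (auto simp: \<A>_def)
  next
    fix \<C> assume "\<C> \<noteq> {}" and chain: "subset.chain \<A> \<C>"
    have \<C>: "I \<in> \<A>" if "I \<in> \<C>" for I
      using chain that by (auto simp: subset.chain_def)
    have "R.subspace (\<Union>\<C>)"
    proof (rule R.subspaceI)
      show "0 \<in> \<Union>\<C>"
        using \<open>\<C> \<noteq> {}\<close> \<C> R.subspace_0 by (auto simp: \<A>_def)
    next
      fix x y assume "x \<in> \<Union>\<C>" "y \<in> \<Union>\<C>"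
      then obtain I I' where I: "I \<in> \<C>" "x \<in> I" "I' \<in> \<C>" "y \<in> I'"
        by blast
      then have "I \<subseteq> I' \<or> I' \<subseteq> I"
        using chain by (auto simp: subset.chain_def)
      then show "x + y \<in> \<Union>\<C>"
        using I \<C> R.subspace_add unfolding \<A>_def by blast
    next
      fix c x assume "x \<in> \<Union>\<C>"
      then show "c * x \<in> \<Union>\<C>"
        using \<C> R.subspace_scale unfolding \<A>_def by blast
    qed
    then show "\<Union>\<C> \<in> \<A>"
      using \<open>\<C> \<noteq> {}\<close> \<C> unfolding \<A>_def by blast
  qed
  then obtain M where M_in: "M \<in> \<A>" and M_max: "\<And>I. I \<in> \<A> \<Longrightarrow> M \<subseteq> I \<Longrightarrow> I = M"
    by blast
  have M: "R.subspace M" "J \<subseteq> M" "1 \<notin> M"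
    using M_in by (auto simp: \<A>_def)
  have maximal: "I = M" if "R.subspace I" "M \<subseteq> I" "1 \<notin> I" for I
    by (rule M_max) (use that M(2) in \<open>auto simp: \<A>_def\<close>)
  have unit_mod_M: "\<exists>m r. m \<in> M \<and> 1 = m + r * a" if "a \<notin> M" for a
  proof -
    define I where "I = {m + r * a | m r. m \<in> M}"
    have I_intro: "m + r * a \<in> I" if "m \<in> M" for m r
      using that unfolding I_def by blast
    have "R.subspace I"
    proof (rule R.subspaceI)
      show "0 \<in> I"
        using I_intro[OF R.subspace_0[OF M(1)], of 0] by simp
    next
      fix x y assume "x \<in> I" "y \<in> I"
      then obtain m r m' r' where "x = m + r * a" "y = m' + r' * a" "m \<in> M" "m' \<in> M"
        unfolding I_def by blast
      then have "x + y = (m + m') + (r + r') * a" "m + m' \<in> M"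
        using R.subspace_add[OF M(1)] by (simp_all add: distrib_right)
      then show "x + y \<in> I"
        unfolding I_def by blast
    next
      fix c x assume "x \<in> I"
      then obtain m r where "x = m + r * a" "m \<in> M"
        unfolding I_def by blast
      then have "c * x = c * m + (c * r) * a" "c * m \<in> M"
        using R.subspace_scale[OF M(1)] by (simp_all add: distrib_left)
      then show "c * x \<in> I"
        unfolding I_def by blast
    qed
    moreover have "m \<in> I" if "m \<in> M" for m
      using I_intro[OF that, of 0] by simp
    moreover have "a \<in> I"
      using I_intro[OF R.subspace_0[OF M(1)], of 1] by simp
    ultimately have "1 \<in> I"
      using maximal[of I] that by blast
    then show ?thesis
      unfolding I_def by blast
  qed
  have "a \<in> M \<or> b \<in> M" if ab: "a * b \<in> M" for a b
  proof (rule ccontr)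
    assume "\<not> (a \<in> M \<or> b \<in> M)"
    then obtain m r m' s where m: "m \<in> M" "1 = m + r * a" and m': "m' \<in> M" "1 = m' + s * b"
      using unit_mod_M by blast
    have "1 = (m + r * a) * (m' + s * b)"
      using m(2) m'(2) by simp
    also have "\<dots> = (m' + s * b) * m + ((r * a) * m' + (r * s) * (a * b))"
      by (simp only: distrib_left distrib_right mult_ac add_ac)
    also have "\<dots> \<in> M"
      by (intro R.subspace_add[OF M(1)] R.subspace_scale[OF M(1)] m m' ab)
    finally show False
      using M(3) by simp
  qed
  then show ?thesis
    using M unfolding prime_ideal_def by blast
qed

context module
begin

lemma subspace_annihilator: "module.subspace (*) {a. scale a x = 0}"
  by (rule module.subspaceI[OF module_mult])
    (simp_all add: scale_left_distrib flip: scale_scale)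

text \<open>The annihilator of a nonzero element is a proper ideal, so some prime contains it, and the
  element survives in the localization there.\<close>

lemma zero_if_locally_zero:
  assumes "\<And>I. prime_ideal I \<Longrightarrow> \<exists>c. c \<notin> I \<and> scale c x = 0"
  shows "x = 0"
proof (rule ccontr)
  assume "x \<noteq> 0"
  then obtain I where "prime_ideal I" "{a. scale a x = 0} \<subseteq> I"
    using proper_ideal_in_prime_ideal[OF subspace_annihilator[of x]] by auto
  with assms show False
    by blast
qed

text \<open>
  Rank one at a prime, with the denominators cleared. The numerator \<open>e\<close> of a generator \<open>e / t\<close> of
  the localization serves for all \<open>p\<close>.
\<close>

lemma rank_one_local_generator:
  assumes "rank_one scale" and I: "prime_ideal I"
  shows "\<exists>e. \<forall>p. \<exists>c d. c \<notin> I \<and> scale c p = scale d e"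
proof -
  define S where "S = - I"
  have one: "1 \<in> S"
    using I unfolding S_def prime_ideal_def by blast
  have mult: "a * b \<in> S" if "a \<in> S" "b \<in> S" for a b
    using I that unfolding S_def prime_ideal_def by blast
  obtain g where "g \<in> loc_carrier scale S"
    and unique: "\<forall>x\<in>loc_carrier scale S.
      \<exists>!\<alpha>. \<alpha> \<in> loc_carrier (*) S \<and> x = loc_scale scale S \<alpha> g"
    using assms(1)[unfolded rank_one_def, THEN spec, THEN mp, OF I] unfolding S_def by (elim bexE)
  have generates: "\<exists>\<alpha>. \<alpha> \<in> loc_carrier (*) S \<and> x = loc_scale scale S \<alpha> g"
    if "x \<in> loc_carrier scale S" for x
    using bspec[OF unique that] by (rule ex1_implies_ex)
  obtain e t where g: "g = loc_frac scale S e t" and t: "t \<in> S"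
    using \<open>g \<in> loc_carrier scale S\<close> unfolding loc_carrier_def by blast
  have "\<exists>c d. c \<notin> I \<and> scale c p = scale d e" for p
  proof -
    have "loc_frac scale S p 1 \<in> loc_carrier scale S"
      using one unfolding loc_carrier_def by blast
    then obtain \<alpha> where \<alpha>: "\<alpha> \<in> loc_carrier (*) S" "loc_frac scale S p 1 = loc_scale scale S \<alpha> g"
      using generates by blast
    have "(p, 1) \<in> loc_frac scale S p 1"
      using one by (auto simp: loc_frac_def)
    then obtain a s q r where as: "(a, s) \<in> \<alpha>" and qr: "(q, r) \<in> g"
      and p: "(p, 1) \<in> loc_frac scale S (scale a q) (s * r)"
      unfolding \<alpha>(2) loc_scale_def by blast
    have s: "s \<in> S"
      using \<alpha>(1) as unfolding loc_carrier_def loc_frac_def by blast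
    obtain v where v: "v \<in> S" "scale v (scale r e - scale t q) = 0" and r: "r \<in> S"
      using qr unfolding g loc_frac_def by blast
    obtain u where u: "u \<in> S" "scale u (scale 1 (scale a q) - scale (s * r) p) = 0"
      using p unfolding loc_frac_def by blast
    have "v * t * (u * (s * r)) \<in> S"
      by (intro mult v(1) t u(1) s r)
    moreover have "scale (v * t * (u * (s * r))) p = scale (u * a * (v * r)) e"
    proof -
      have "scale (v * t * (u * (s * r))) p = scale (v * t) (scale u (scale (s * r) p))"
        by (simp add: mult_ac)
      also have "scale u (scale (s * r) p) = scale u (scale a q)"
        using u(2) by (simp add: scale_right_diff_distrib)
      also have "scale (v * t) (scale u (scale a q)) = scale (u * a) (scale v (scale t q))"
        by (simp add: mult_ac)
      also have "scale v (scale t q) = scale v (scale r e)"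
        using v(2) by (simp add: scale_right_diff_distrib)
      finally show ?thesis
        by (simp add: mult_ac)
    qed
    ultimately show ?thesis
      unfolding S_def by blast
  qed
  then show ?thesis
    by blast
qed

text \<open>If \<open>p\<close> and \<open>q\<close> are multiples \<open>d e\<close> and \<open>d' e\<close> of one element, both sides are
  \<open>d d' X(e) e\<close>. In rank one this is the situation at every prime.\<close>

lemma rank_one_functional_symmetric:
  assumes "rank_one scale" and X: "module_hom scale (*) X"
  shows "scale (X p) q = scale (X q) p"
proof -
  have X_scale: "X (scale c x) = c * X x" for c x
    by (rule module_hom.scale[OF X])
  have "\<exists>c. c \<notin> I \<and> scale c (scale (X p) q - scale (X q) p) = 0" if I: "prime_ideal I" for I
  proof -
    obtain e c c' d d' where c: "c \<notin> I" "scale c p = scale d e" "c' \<notin> I" "scale c' q = scale d' e"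
      using rank_one_local_generator[OF assms(1) I] by meson
    have "scale (c * c') (scale (X p) q) = scale (X (scale c p)) (scale c' q)"
      by (simp add: X_scale mult_ac)
    also have "\<dots> = scale (d * d' * X e) e"
      unfolding c by (simp add: X_scale mult_ac)
    also have "\<dots> = scale (X (scale c' q)) (scale c p)"
      unfolding c by (simp add: X_scale mult_ac)
    also have "\<dots> = scale (c * c') (scale (X q) p)"
      by (simp add: X_scale mult_ac)
    finally have "scale (c * c') (scale (X p) q - scale (X q) p) = 0"
      by (simp add: scale_right_diff_distrib)
    moreover have "c * c' \<notin> I"
      using c I unfolding prime_ideal_def by blast
    ultimately show ?thesis
      by blast
  qed
  then have "scale (X p) q - scale (X q) p = 0"
    by (rule zero_if_locally_zero)
  then show ?thesis
    by simp
qed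

text \<open>Over the zero module the coefficient of a generator would not be unique, since the
  localized ring has \<open>0 / 1 \<noteq> 1 / 1\<close>.\<close>

lemma rank_one_nontrivial:
  assumes "rank_one scale"
  shows "\<exists>p :: 'b. p \<noteq> 0"
proof (rule ccontr)
  assume "\<nexists>p :: 'b. p \<noteq> 0"
  then have trivial: "p = 0" for p :: 'b
    by blast
  obtain I :: "'a set" where I: "prime_ideal I"
    using proper_ideal_in_prime_ideal[of "{0}"] module.subspace_single_0[OF module_mult] by auto
  define S where "S = - I"
  have one: "1 \<in> S" and zero: "0 \<notin> S"
    using I module.subspace_0[OF module_mult] unfolding S_def prime_ideal_def by blast+
  have frac: "loc_frac scale S p s = UNIV \<times> S" for p s
    using one trivial unfolding loc_frac_def by blast
  have fraction_nonempty: "(a, 1) \<in> loc_frac (*) S a 1" for a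
    using one by (auto simp: loc_frac_def)
  have "(0, 1) \<notin> loc_frac (*) S 1 1"
    using zero by (auto simp: loc_frac_def)
  with fraction_nonempty[of 0] have distinct: "loc_frac (*) S 0 1 \<noteq> loc_frac (*) S 1 1"
    by blast
  obtain g where g_in: "g \<in> loc_carrier scale S"
    and unique: "\<forall>x\<in>loc_carrier scale S.
      \<exists>!\<alpha>. \<alpha> \<in> loc_carrier (*) S \<and> x = loc_scale scale S \<alpha> g"
    using assms(1)[unfolded rank_one_def, THEN spec, THEN mp, OF I] unfolding S_def by (elim bexE)
  have g: "g = UNIV \<times> S"
    using g_in unfolding loc_carrier_def frac by blast
  obtain \<beta> where \<beta>: "\<And>\<alpha>. \<alpha> \<in> loc_carrier (*) S \<Longrightarrow> g = loc_scale scale S \<alpha> g \<Longrightarrow> \<alpha> = \<beta>"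
    using bspec[OF unique g_in] by (elim ex1E) blast
  have "loc_frac (*) S a 1 = \<beta>" for a
  proof (rule \<beta>)
    show "loc_frac (*) S a 1 \<in> loc_carrier (*) S"
      using one unfolding loc_carrier_def by blast
    show "g = loc_scale scale S (loc_frac (*) S a 1) g"
      unfolding loc_scale_def frac g using fraction_nonempty[of a] one by blast
  qed
  with distinct show False
    by blast
qed

text \<open>Some coordinate of the image of \<open>p\<close> in the ambient free module is nonzero.\<close>

lemma projective_nonzero_functional:
  assumes "projective_module scale" "p \<noteq> 0"
  shows "\<exists>X. module_hom scale (*) X \<and> X p \<noteq> 0"
proof -
  obtain \<iota> :: "'b \<Rightarrow> ('b \<Rightarrow>\<^sub>0 'a)" and \<pi> where \<iota>: "module_hom scale free_scale \<iota>"
    and \<pi>: "module_hom free_scale scale \<pi>" and \<pi>\<iota>: "\<And>p. \<pi> (\<iota> p) = p"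
    using assms(1) unfolding projective_module_def by blast
  interpret \<iota>: module_hom scale free_scale \<iota> by fact
  interpret \<pi>: module_hom free_scale scale \<pi> by fact
  have "\<iota> p \<noteq> 0"
    using \<pi>\<iota>[of p] \<open>p \<noteq> 0\<close> by auto
  then obtain i where "Poly_Mapping.lookup (\<iota> p) i \<noteq> 0"
    by (metis lookup_zero poly_mapping_eqI)
  moreover have "module_hom scale (*) (\<lambda>q. Poly_Mapping.lookup (\<iota> q) i)"
    by (intro module_hom.intro module_axioms module_mult module_hom_axioms.intro)
      (simp_all add: \<iota>.add \<iota>.scale lookup_add)
  ultimately show ?thesis
    by blast
qed

end

section \<open>Graded operators on a diolic algebra by degree\<close>

theorem theorem31:
  fixes scA :: "'k::field_char_0 \<Rightarrow> 'a::comm_ring_1 \<Rightarrow> 'a"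
    and sm :: "'a \<Rightarrow> 'p::ab_group_add \<Rightarrow> 'p"
    and k :: nat
  assumes "diolic_algebra scA sm" and "k \<ge> 1"
  shows
    "bij_betw (\<lambda>\<phi>. (\<lambda>a. fst (\<phi> (a, 0)), \<lambda>p. snd (\<phi> (0, p))))
       (diolic_Diff scA sm k 0)
       {(D, E). D \<in> Diff scA (*) (*) k \<and> E \<in> Diff scA sm sm k \<and> same_symbol sm k D E}
     \<and>
     submodule_iso
       (\<lambda>a \<phi> x. dmult sm (a, 0) (\<phi> x)) (diolic_Diff scA sm k 1)
       (\<lambda>a D b. sm a (D b)) (Diff scA (*) sm k)
       (\<lambda>\<phi> a. snd (\<phi> (a, 0)))
     \<and>
     (projective_module sm \<and> rank_one sm \<longrightarrow>
        (\<exists>\<phi> \<in> diolic_Diff scA sm k (-1). \<phi> \<noteq> (\<lambda>_. 0)) \<and>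
        inj_on (\<lambda>\<phi> p. fst (\<phi> (0, p))) (diolic_Diff scA sm k (-1)) \<and>
        (\<lambda>\<phi> p. fst (\<phi> (0, p))) ` diolic_Diff scA sm k (-1) \<subseteq> Diff scA sm (*) k)"
proof (intro conjI impI)
  interpret diolic_algebra scA sm by fact
  show "bij_betw (\<lambda>\<phi>. (\<lambda>a. fst (\<phi> (a, 0)), \<lambda>p. snd (\<phi> (0, p))))
      (diolic_Diff scA sm k 0)
      {(D, E). D \<in> Diff scA (*) (*) k \<and> E \<in> Diff scA sm sm k \<and> same_symbol sm k D E}"
    unfolding diolic_Diff_0_eq
  proof (rule bij_betw_byWitness[where f' = "\<lambda>(D, E). map_prod D E"])
    let ?pairs = "{(D, E). D \<in> Diff scA (*) (*) k \<and> E \<in> Diff scA sm sm k \<and> same_symbol sm k D E}"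
    let ?restrict = "\<lambda>\<phi>. (\<lambda>a. fst (\<phi> (a, 0 :: 'p)), \<lambda>p. snd (\<phi> (0 :: 'a, p)))"
    show "\<forall>\<phi>\<in>(\<lambda>(D, E). map_prod D E) ` ?pairs. (\<lambda>(D, E). map_prod D E) (?restrict \<phi>) = \<phi>"
      by auto
    show "\<forall>DE\<in>?pairs. ?restrict ((\<lambda>(D, E). map_prod D E) DE) = DE"
      by auto
    show "?restrict ` (\<lambda>(D, E). map_prod D E) ` ?pairs \<subseteq> ?pairs"
      by auto
  qed simp
  show "submodule_iso (\<lambda>a \<phi> x. dmult sm (a, 0) (\<phi> x)) (diolic_Diff scA sm k 1)
      (\<lambda>a D b. sm a (D b)) (Diff scA (*) sm k) (\<lambda>\<phi> a. snd (\<phi> (a, 0)))"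
    by (rule submodule_iso_diolic_Diff_1)
  show "inj_on (\<lambda>\<phi> p. fst (\<phi> (0, p))) (diolic_Diff scA sm k (- 1))"
  proof (rule inj_on_subset[OF _ diolic_Diff_minus_1_subset])
    show "inj_on (\<lambda>\<phi> p. fst (\<phi> (0, p))) (degree_minus_one_map ` Diff scA sm (*) k)"
      by (auto simp: inj_on_def degree_minus_one_map_def)
  qed
  show "(\<lambda>\<phi> p. fst (\<phi> (0, p))) ` diolic_Diff scA sm k (- 1) \<subseteq> Diff scA sm (*) k"
    using diolic_Diff_minus_1_subset[of k] by (auto simp: degree_minus_one_map_def)
  assume "projective_module sm \<and> rank_one sm"
  then obtain p X where X: "module_hom sm (*) X" and "X p \<noteq> 0"
    using P.rank_one_nontrivial P.projective_nonzero_functional by blast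
  have "degree_minus_one_map X \<in> diolic_Diff scA sm k (- 1)"
    using symmetric_functional_in_diolic_Diff[OF X P.rank_one_functional_symmetric[OF _ X]]
      \<open>k \<ge> 1\<close> \<open>projective_module sm \<and> rank_one sm\<close> by blast
  moreover have "degree_minus_one_map X \<noteq> (\<lambda>_. 0)"
    using \<open>X p \<noteq> 0\<close> by auto
  ultimately show "\<exists>\<phi>\<in>diolic_Diff scA sm k (- 1). \<phi> \<noteq> (\<lambda>_. 0)"
    by blast
qed

end
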